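(* Let $r\ge 1$ and let $K$ be an $r$-dimensional finite simplicial complex. Then the largest eigenvalue $\lambda_{r-1,1}(K)$ of the $(r-1)$-dimensional up-Laplacian of $K$ satisfies \[ \lambda_{r-1,1}(K)\le\frac{r+1}{2}\,f_r(K)+\frac{f_{r-2}(K)}{r}. \]
   Context: A (finite abstract) simplicial complex $K$ on a finite vertex set $V$ is a collection of subsets of $V$ closed under inclusion. An element of cardinality $i+1$ is an $i$-face; the dimension of $K$ is the maximum dimension of its faces. $S_i(K)$ is the set of $i$-faces and $f_i(K)=|S_i(K)|$, with $S_{-1}(K)=\{\emptyset\}$ and $f_{-1}(K)=1$. Fix a linear order on $V$ and orient every face by the increasing order of its vertices. The $i$-th boundary map $\partial_i:C_i(K;\mathbb R)\to C_{i-1}(K;\mathbb R)$ between real chain spaces (with bases the oriented faces) is $\partial_i[v_0,\dots,v_i]=\sum_{j=0}^i(-1)^j[v_0,\dots,\widehat{v_j},\dots,v_i]$, and $B_i(K)\in\mathbb R^{f_{i-1}(K)\times f_i(K)}$ is its matrix. The $i$-dimensional up-Laplacian is $L_i^{\mathrm{up}}(K)=B_{i+1}(K)B_{i+1}(K)^\top$, and $\lambda_{i,1}(K)$ denotes its largest eigenvalue. *)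

theory Defs
  imports "HOL-Library.Countable_Set" "Jordan_Normal_Form.Spectral_Radius"
begin

text \<open>The empty face is required to be present, in line with the conventions
  \<open>S\<^sub>-\<^sub>1(K) = {\<emptyset>}\<close> and \<open>f\<^sub>-\<^sub>1(K) = 1\<close>; among downward closed families this only excludes
  the empty family, which has no dimension.\<close>

definition simplicial_complex :: "'a set \<Rightarrow> 'a set set \<Rightarrow> bool" where
  "simplicial_complex V K \<longleftrightarrow>
     finite V \<and> K \<subseteq> Pow V \<and> {} \<in> K \<and> (\<forall>\<sigma>\<in>K. \<forall>\<tau>. \<tau> \<subseteq> \<sigma> \<longrightarrow> \<tau> \<in> K)"

text \<open>Dimensions are integers, so that the index \<open>-1\<close> is available.\<close>

definition faces :: "'a set set \<Rightarrow> int \<Rightarrow> 'a set set" where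
  "faces K i = {\<sigma> \<in> K. int (card \<sigma>) = i + 1}"

definition face_count :: "'a set set \<Rightarrow> int \<Rightarrow> nat" where
  "face_count K i = card (faces K i)"

definition complex_dim :: "'a set set \<Rightarrow> int" where
  "complex_dim K = Max ((\<lambda>\<sigma>. int (card \<sigma>) - 1) ` K)"

text \<open>A real chain is represented by its coefficient function on faces.  A face \<open>\<sigma>\<close> stands for
  the oriented simplex \<open>[v\<^sub>0, \<dots>, v\<^sub>i]\<close> that lists its vertices in increasing order, and
  \<open>boundary \<sigma>\<close> is the chain \<open>\<Sum>j. (-1)^j [v\<^sub>0, \<dots>, v\<^sub>j omitted, \<dots>, v\<^sub>i]\<close>.\<close>

definition boundary :: "'a::linorder set \<Rightarrow> 'a set \<Rightarrow> real" where
  "boundary \<sigma> =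
     (\<lambda>\<tau>. \<Sum>j<card \<sigma>. (- 1) ^ j * of_bool (\<tau> = \<sigma> - {sorted_list_of_set \<sigma> ! j}))"

text \<open>Rows and columns are indexed through \<open>from_nat_into\<close>, which enumerates a finite set \<open>S\<close>
  bijectively by \<open>{..<card S}\<close>.  Another enumeration would only conjugate the Laplacian
  by a permutation matrix.\<close>

definition boundary_matrix :: "'a::linorder set set \<Rightarrow> int \<Rightarrow> real mat" where
  "boundary_matrix K i =
     mat (face_count K (i - 1)) (face_count K i)
       (\<lambda>(a, b). boundary (from_nat_into (faces K i) b) (from_nat_into (faces K (i - 1)) a))"

definition up_laplacian :: "'a::linorder set set \<Rightarrow> int \<Rightarrow> real mat" where
  "up_laplacian K i = boundary_matrix K (i + 1) * transpose_mat (boundary_matrix K (i + 1))"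

text \<open>Only meaningful for matrices with a nonempty real spectrum, such as symmetric real matrices
  of positive dimension.\<close>

definition largest_eigenvalue :: "real mat \<Rightarrow> real" where
  "largest_eigenvalue A = Max (spectrum A)"

end

theory Submission
  imports Defs
begin

text \<open>The nonzero eigenvalues of \<open>B B\<^sup>T\<close>, where \<open>B = B\<^sub>r(K)\<close>, are those of \<open>B\<^sup>T B\<close>.  That matrix has
  diagonal entries \<open>r + 1\<close>, and its other entries have absolute value at most 1, because two
  distinct \<open>r\<close>-faces share at most one \<open>(r-1)\<close>-face.  Bounding by absolute row sums gives
  \<open>\<lambda> \<le> f\<^sub>r + r\<close>, which implies the claim since \<open>f\<^sub>r \<ge> 1\<close> and a single \<open>r\<close>-face already
  contributes \<open>r (r + 1) / 2\<close> faces of dimension \<open>r - 2\<close>.\<close>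

text \<open>\<open>largest_eigenvalue\<close> is a \<open>Max\<close> over the real spectrum, so
  this set must be shown nonempty. A complex eigenvalue exists because the field is algebraically
  closed. Symmetry forces it to be real, and a real root of the characteristic polynomial over the
  complex numbers is already a root over the reals.\<close>

lemma symmetric_spectrum_nonempty:
  fixes A :: "real mat"
  assumes A: "A \<in> carrier_mat n n" and n: "n \<noteq> 0" and sym: "transpose_mat A = A"
  shows "spectrum A \<noteq> {}"
proof -
  define C where "C = map_mat complex_of_real A"
  have C: "C \<in> carrier_mat n n" using A by (simp add: C_def)
  have "transpose_mat C = map_mat complex_of_real (transpose_mat A)"
    using A unfolding C_def by (intro eq_matI) auto
  then have symC: "transpose_mat C = C" by (simp add: sym C_def)
  from spectrum_non_empty[OF C] n obtain k where k: "eigenvalue C k"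
    unfolding spectrum_def by auto
  then obtain v where v: "v \<in> carrier_vec n" "v \<noteq> 0\<^sub>v n" "C *\<^sub>v v = k \<cdot>\<^sub>v v"
    unfolding eigenvalue_def eigenvector_def using C by auto
  have cv: "conjugate v \<in> carrier_vec n" using v by simp
  \<comment> \<open>The entries of \<open>C\<close> are real, so conjugation passes through the
    product.\<close>
  have "C *\<^sub>v conjugate v = conjugate (C *\<^sub>v v)"
    using v(1) C A
    by (intro eq_vecI) (auto simp: C_def scalar_prod_def intro!: sum.cong)
  also have "\<dots> = cnj k \<cdot>\<^sub>v conjugate v"
    using v(1) unfolding v(3) by (intro eq_vecI) auto
  finally have conj: "C *\<^sub>v conjugate v = cnj k \<cdot>\<^sub>v conjugate v" .
  \<comment> \<open>Symmetry moves \<open>C\<close> from one factor of the bilinear product to the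
    other, yielding \<open>k\<close> on one side and \<open>cnj k\<close> on the other.\<close>
  have "(k \<cdot>\<^sub>v v) \<bullet> conjugate v = v \<bullet> (cnj k \<cdot>\<^sub>v conjugate v)"
    using transpose_vec_mult_scalar[OF C cv v(1)] by (simp add: symC v(3) conj)
  then have "k * (v \<bullet>c v) = cnj k * (v \<bullet>c v)"
    using v(1) cv by simp
  moreover have "v \<bullet>c v \<noteq> 0"
    using v(1,2) by (simp add: conjugate_square_eq_0_vec)
  ultimately have "cnj k = k" by simp
  then have "k = complex_of_real (Re k)"
    by (simp add: complex_eq_iff)
  with k have "poly (char_poly C) (complex_of_real (Re k)) = 0"
    using eigenvalue_root_char_poly[OF C] by simp
  then have "poly (char_poly A) (Re k) = 0"
    unfolding C_def of_real_hom.char_poly_hom[OF A] by simp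
  then show ?thesis
    unfolding spectrum_root_char_poly[OF A] by auto
qed

text \<open>An eigenvector \<open>x\<close> for \<mu> > c is carried by the transpose of
  \<open>B\<close> to an eigenvector \<open>y\<close> of the other Gram matrix, with the same
  eigenvalue. Reading that equation at a coordinate where \<open>y\<close> has maximal modulus
  bounds \<mu> by an absolute row sum. The condition \<open>0 \<le> c\<close> takes care of the
  eigenvalue 0, which need not be shared by the two Gram matrices.\<close>

lemma eigenvalue_gram_le:
  fixes B :: "real mat"
  assumes B: "B \<in> carrier_mat m n" and ev: "eigenvalue (B * transpose_mat B) \<mu>"
    and c: "0 \<le> c"
    and rows: "\<And>i. i < n \<Longrightarrow> (\<Sum>j<n. \<Sum>a<m. \<bar>B $$ (a, i)\<bar> * \<bar>B $$ (a, j)\<bar>) \<le> c"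
  shows "\<mu> \<le> c"
proof (rule ccontr)
  assume "\<not> \<mu> \<le> c"
  then have \<mu>: "c < \<mu>" by simp
  obtain x where x: "x \<in> carrier_vec m" "x \<noteq> 0\<^sub>v m"
    "(B * transpose_mat B) *\<^sub>v x = \<mu> \<cdot>\<^sub>v x"
    using ev B unfolding eigenvalue_def eigenvector_def by auto
  define y where "y = transpose_mat B *\<^sub>v x"
  have y: "y \<in> carrier_vec n" using B x(1) unfolding y_def
    by (intro mult_mat_vec_carrier[of _ n m]) auto
  have By: "B *\<^sub>v y = \<mu> \<cdot>\<^sub>v x"
    using x B unfolding y_def by (metis assoc_mult_mat_vec transpose_carrier_mat)
  have eig: "transpose_mat B *\<^sub>v (B *\<^sub>v y) = \<mu> \<cdot>\<^sub>v y"
    unfolding By using x B unfolding y_def by (intro mult_mat_vec) auto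
  \<comment> \<open>Otherwise \<mu> x = B y vanishes, although \<mu> > c \<ge> 0 and
    \<open>x\<close> is nonzero.\<close>
  have "y \<noteq> 0\<^sub>v n"
  proof
    assume "y = 0\<^sub>v n"
    then have "\<mu> \<cdot>\<^sub>v x = 0\<^sub>v m"
      using By B by (intro eq_vecI) (auto simp flip: By)
    moreover obtain a where "a < m" "x $ a \<noteq> 0"
      using x(1,2) by (metis carrier_vecD eq_vecI index_zero_vec)
    ultimately have "\<mu> * x $ a = 0"
      using x(1) by (metis carrier_vecD index_smult_vec(1) index_zero_vec(1))
    with \<open>x $ a \<noteq> 0\<close> \<mu> c show False by simp
  qed
  then obtain l where l: "l < n" "y $ l \<noteq> 0"
    using y by (metis carrier_vecD eq_vecI index_zero_vec)
  define M where "M = Max ((\<lambda>j. \<bar>y $ j\<bar>) ` {..<n})"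
  have le_M: "\<bar>y $ j\<bar> \<le> M" if "j < n" for j
    unfolding M_def using that by (intro Max_ge) auto
  have "M \<in> (\<lambda>j. \<bar>y $ j\<bar>) ` {..<n}"
    unfolding M_def using l by (intro Max_in) auto
  then obtain i where i: "i < n" "\<bar>y $ i\<bar> = M" by auto
  have M: "0 < M" using l le_M[of l] by linarith
  have "\<mu> * y $ i = (transpose_mat B *\<^sub>v (B *\<^sub>v y)) $ i"
    using i y by (simp add: eig)
  also have "\<dots> = (\<Sum>a<m. B $$ (a, i) * (\<Sum>j<n. B $$ (a, j) * y $ j))"
    using i y B by (auto simp: scalar_prod_def atLeast0LessThan intro!: sum.cong)
  also have "\<dots> = (\<Sum>j<n. \<Sum>a<m. B $$ (a, i) * B $$ (a, j) * y $ j)"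
    by (subst sum.swap) (simp add: sum_distrib_left mult.assoc)
  finally have "\<mu> * M = \<bar>\<Sum>j<n. \<Sum>a<m. B $$ (a, i) * B $$ (a, j) * y $ j\<bar>"
    using i \<mu> c by (metis abs_mult abs_of_nonneg le_less_trans less_imp_le)
  also have "\<dots> \<le> (\<Sum>j<n. \<Sum>a<m. \<bar>B $$ (a, i) * B $$ (a, j) * y $ j\<bar>)"
    by (intro order_trans[OF sum_abs] sum_mono sum_abs)
  also have "\<dots> \<le> (\<Sum>j<n. \<Sum>a<m. \<bar>B $$ (a, i)\<bar> * \<bar>B $$ (a, j)\<bar> * M)"
    by (intro sum_mono) (auto simp: abs_mult intro!: mult_left_mono le_M)
  also have "\<dots> = (\<Sum>j<n. \<Sum>a<m. \<bar>B $$ (a, i)\<bar> * \<bar>B $$ (a, j)\<bar>) * M"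
    by (simp add: sum_distrib_right)
  also have "\<dots> \<le> c * M"
    using rows[OF i(1)] M by (intro mult_right_mono) auto
  finally show False using \<mu> M by simp
qed

text \<open>The sorted list of vertices has no repetition, so at most one index \<open>j\<close>
  contributes to the alternating sum, and its term is a sign. The orientation is irrelevant from
  here on.\<close>

lemma abs_boundary_le:
  assumes "finite \<sigma>"
  shows "\<bar>boundary \<sigma> \<tau>\<bar> \<le> of_bool (\<exists>v\<in>\<sigma>. \<tau> = \<sigma> - {v})"
proof (cases "\<exists>v\<in>\<sigma>. \<tau> = \<sigma> - {v}")
  case True
  then obtain v where v: "v \<in> \<sigma>" "\<tau> = \<sigma> - {v}" by blast
  define xs where "xs = sorted_list_of_set \<sigma>"
  have xs: "distinct xs" "set xs = \<sigma>" "length xs = card \<sigma>"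
    using assms by (auto simp: xs_def)
  then obtain k where k: "k < card \<sigma>" "xs ! k = v"
    using v by (metis in_set_conv_nth)
  have "\<tau> = \<sigma> - {xs ! j} \<longleftrightarrow> j = k" if "j < card \<sigma>" for j
  proof -
    have "xs ! j \<in> \<sigma>" using that xs by (metis nth_mem)
    then have "\<tau> = \<sigma> - {xs ! j} \<longleftrightarrow> xs ! j = xs ! k" using v k by auto
    also have "\<dots> \<longleftrightarrow> j = k"
      using xs k(1) that by (simp add: nth_eq_iff_index_eq)
    finally show ?thesis .
  qed
  then have "boundary \<sigma> \<tau> = (\<Sum>j<card \<sigma>. if j = k then (- 1) ^ j else 0)"
    unfolding boundary_def xs_def[symmetric] by (intro sum.cong) auto
  also have "\<dots> = (- 1) ^ k" using k by simp
  finally show ?thesis using True by (simp add: power_abs)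
next
  case False
  have "sorted_list_of_set \<sigma> ! j \<in> \<sigma>" if "j < card \<sigma>" for j
    using that assms by (metis nth_mem length_sorted_list_of_set set_sorted_list_of_set)
  with False have "boundary \<sigma> \<tau> = 0"
    unfolding boundary_def by (intro sum.neutral) auto
  with False show ?thesis by simp
qed

text \<open>The sum is at most the number of common facets in \<open>T\<close>. A face has at most
  one facet per vertex, and two distinct faces can share only their intersection.\<close>

lemma sum_abs_boundary_mult_le:
  assumes fin: "finite T" "finite \<sigma>" "finite \<sigma>'" and card: "card \<sigma> = card \<sigma>'"
  shows "(\<Sum>\<tau>\<in>T. \<bar>boundary \<sigma> \<tau>\<bar> * \<bar>boundary \<sigma>' \<tau>\<bar>)
           \<le> (if \<sigma> = \<sigma>' then real (card \<sigma>) else 1)"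
proof -
  define P where "P \<rho> \<tau> \<longleftrightarrow> (\<exists>v\<in>\<rho>. \<tau> = \<rho> - {v})" for \<rho> \<tau> :: "'a set"
  define U where "U = {\<tau>\<in>T. P \<sigma> \<tau> \<and> P \<sigma>' \<tau>}"
  have "(\<Sum>\<tau>\<in>T. \<bar>boundary \<sigma> \<tau>\<bar> * \<bar>boundary \<sigma>' \<tau>\<bar>)
      \<le> (\<Sum>\<tau>\<in>T. of_bool (P \<sigma> \<tau>) * of_bool (P \<sigma>' \<tau>))"
    unfolding P_def using fin by (intro sum_mono mult_mono abs_boundary_le) auto
  also have "\<dots> = (\<Sum>\<tau>\<in>T. if P \<sigma> \<tau> \<and> P \<sigma>' \<tau> then 1 else 0)"
    by (intro sum.cong) auto
  also have "\<dots> = real (card U)"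
    using fin by (simp add: U_def sum.If_cases Int_def)
  also have "\<dots> \<le> (if \<sigma> = \<sigma>' then real (card \<sigma>) else 1)"
  proof (cases "\<sigma> = \<sigma>'")
    case True
    have "U \<subseteq> (\<lambda>v. \<sigma> - {v}) ` \<sigma>" unfolding U_def P_def by auto
    then have "card U \<le> card \<sigma>" using surj_card_le[OF fin(2)] by blast
    with True show ?thesis by simp
  next
    case False
    have "U \<subseteq> {\<sigma> \<inter> \<sigma>'}"
    proof
      fix \<tau> assume "\<tau> \<in> U"
      then obtain v v' where v: "v \<in> \<sigma>" "\<tau> = \<sigma> - {v}" "v' \<in> \<sigma>'" "\<tau> = \<sigma>' - {v'}"
        unfolding U_def P_def by auto
      \<comment> \<open>Here \<open>v\<close> and \<open>v'\<close> differ, since equality would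
        make the two faces coincide; hence they meet exactly in \<tau>.\<close>
      have "\<sigma> = insert v \<tau>" "\<sigma>' = insert v' \<tau>" "v \<notin> \<tau>" "v' \<notin> \<tau>" using v by auto
      with False show "\<tau> \<in> {\<sigma> \<inter> \<sigma>'}" by auto
    qed
    then have "card U \<le> card {\<sigma> \<inter> \<sigma>'}" by (intro card_mono) auto
    with False show ?thesis by simp
  qed
  finally show ?thesis .
qed

text \<open>The diagonal contributes at most d + 1 and every other column at most 1. The
  enumerations by \<open>from_nat_into\<close> are bijections, so sums over indices become sums over
  faces.\<close>

lemma boundary_matrix_row_sum_le:
  fixes K :: "'a::linorder set set" and d :: nat
  assumes K: "simplicial_complex V K" and i: "i < face_count K (int d)"
  shows "(\<Sum>j<face_count K (int d). \<Sum>a<face_count K (int d - 1).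
            \<bar>boundary_matrix K (int d) $$ (a, i)\<bar> * \<bar>boundary_matrix K (int d) $$ (a, j)\<bar>)
           \<le> real (face_count K (int d)) + real d"
proof -
  let ?S = "faces K (int d)" and ?T = "faces K (int d - 1)"
  have fin: "finite K" "\<And>\<sigma>. \<sigma> \<in> K \<Longrightarrow> finite \<sigma>"
    using K finite_subset[of K "Pow V"] finite_subset[of _ V]
    unfolding simplicial_complex_def by auto
  have finS: "finite ?S" and finT: "finite ?T" using fin(1) by (auto simp: faces_def)
  define \<sigma> where "\<sigma> = from_nat_into ?S i"
  have bS: "bij_betw (from_nat_into ?S) {..<face_count K (int d)} ?S"
    unfolding face_count_def by (rule bij_betw_from_nat_into_finite[OF finS])
  have bT: "bij_betw (from_nat_into ?T) {..<face_count K (int d - 1)} ?T"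
    unfolding face_count_def by (rule bij_betw_from_nat_into_finite[OF finT])
  have \<sigma>: "\<sigma> \<in> ?S" using bS i unfolding \<sigma>_def by (auto simp: bij_betw_def)
  \<comment> \<open>Splitting the diagonal bound d + 1 as 1 plus d lets the ones add up to the
    number of d-faces, with a single extra d.\<close>
  have inner: "(\<Sum>\<tau>\<in>?T. \<bar>boundary \<sigma> \<tau>\<bar> * \<bar>boundary \<sigma>' \<tau>\<bar>)
      \<le> 1 + (if \<sigma>' = \<sigma> then real d else 0)" if "\<sigma>' \<in> ?S" for \<sigma>'
  proof -
    have "card \<sigma> = d + 1" "card \<sigma>' = d + 1" "finite \<sigma>" "finite \<sigma>'"
      using \<sigma> that fin by (auto simp: faces_def)
    then show ?thesis
      using sum_abs_boundary_mult_le[OF finT, of \<sigma> \<sigma>'] by (auto split: if_splits)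
  qed
  have "(\<Sum>j<face_count K (int d). \<Sum>a<face_count K (int d - 1).
            \<bar>boundary_matrix K (int d) $$ (a, i)\<bar> * \<bar>boundary_matrix K (int d) $$ (a, j)\<bar>)
      = (\<Sum>j<face_count K (int d). \<Sum>a<face_count K (int d - 1).
            \<bar>boundary \<sigma> (from_nat_into ?T a)\<bar> *
            \<bar>boundary (from_nat_into ?S j) (from_nat_into ?T a)\<bar>)"
    using i by (intro sum.cong) (auto simp: boundary_matrix_def \<sigma>_def)
  also have "\<dots> = (\<Sum>j<face_count K (int d). \<Sum>\<tau>\<in>?T.
            \<bar>boundary \<sigma> \<tau>\<bar> * \<bar>boundary (from_nat_into ?S j) \<tau>\<bar>)"
    by (intro sum.cong refl sum.reindex_bij_betw[OF bT])
  also have "\<dots> = (\<Sum>\<sigma>'\<in>?S. \<Sum>\<tau>\<in>?T. \<bar>boundary \<sigma> \<tau>\<bar> * \<bar>boundary \<sigma>' \<tau>\<bar>)"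
    by (rule sum.reindex_bij_betw[OF bS])
  also have "\<dots> \<le> (\<Sum>\<sigma>'\<in>?S. 1 + (if \<sigma>' = \<sigma> then real d else 0))"
    by (intro sum_mono inner)
  also have "\<dots> = real (face_count K (int d)) + real d"
    using \<sigma> finS by (simp add: sum.distrib face_count_def)
  finally show ?thesis .
qed

text \<open>Downward closure turns every m-subset of a face into a face of dimension m - 1. For m =
  0 this counts the empty face in dimension -1.\<close>

lemma choose_le_face_count:
  assumes K: "simplicial_complex V K" and \<sigma>: "\<sigma> \<in> K"
  shows "card \<sigma> choose m \<le> face_count K (int m - 1)"
proof -
  have fin: "finite K" "finite \<sigma>"
    using K \<sigma> finite_subset[of K "Pow V"] finite_subset[of \<sigma> V]
    unfolding simplicial_complex_def by auto
  have "{\<tau>. \<tau> \<subseteq> \<sigma> \<and> card \<tau> = m} \<subseteq> faces K (int m - 1)"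
    using K \<sigma> unfolding simplicial_complex_def faces_def by auto
  then have "card {\<tau>. \<tau> \<subseteq> \<sigma> \<and> card \<tau> = m} \<le> face_count K (int m - 1)"
    unfolding face_count_def using fin by (intro card_mono) (auto simp: faces_def)
  then show ?thesis using n_subsets[OF fin(2)] by simp
qed

text \<open>The hypothesis \<open>pos\<close> gives the Laplacian positive size, so its spectrum is
  nonempty and finite, and bounding every eigenvalue bounds the \<open>Max\<close>.\<close>

lemma largest_eigenvalue_up_laplacian_le:
  fixes K :: "'a::linorder set set" and d :: nat
  assumes K: "simplicial_complex V K" and pos: "face_count K (int d - 1) \<noteq> 0"
  shows "largest_eigenvalue (up_laplacian K (int d - 1)) \<le> real (face_count K (int d)) + real d"
proof -
  define B where "B = boundary_matrix K (int d)"
  define L where "L = B * transpose_mat B"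
  have L_eq: "up_laplacian K (int d - 1) = L"
    by (simp add: up_laplacian_def L_def B_def)
  have B: "B \<in> carrier_mat (face_count K (int d - 1)) (face_count K (int d))"
    by (simp add: B_def boundary_matrix_def)
  have L: "L \<in> carrier_mat (face_count K (int d - 1)) (face_count K (int d - 1))"
    using B by (simp add: L_def)
  have "transpose_mat L = L"
    using B unfolding L_def by (subst transpose_mult) auto
  with L pos have "spectrum L \<noteq> {}" by (intro symmetric_spectrum_nonempty)
  moreover have "\<mu> \<le> real (face_count K (int d)) + real d" if "\<mu> \<in> spectrum L" for \<mu>
  proof (rule eigenvalue_gram_le[OF B])
    show "eigenvalue (B * transpose_mat B) \<mu>"
      using that by (simp add: spectrum_def L_def)
  qed (use boundary_matrix_row_sum_le[OF K] in \<open>auto simp: B_def\<close>)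
  ultimately show ?thesis
    unfolding L_eq largest_eigenvalue_def using card_finite_spectrum(1)[OF L] by simp
qed

theorem corollary1p7:
  fixes V :: "'a::linorder set" and K :: "'a set set" and r :: nat
  assumes "r \<ge> 1"
    and "simplicial_complex V K"
    and "complex_dim K = int r"
  shows "largest_eigenvalue (up_laplacian K (int r - 1))
           \<le> (real r + 1) / 2 * real (face_count K (int r))
              + real (face_count K (int r - 2)) / real r"
proof -
  have K: "finite K" "K \<noteq> {}"
    using assms(2) finite_subset[of K "Pow V"] unfolding simplicial_complex_def by auto
  \<comment> \<open>The maximum is attained, which supplies an r-face; its subsets give all the
    lower bounds on face counts below.\<close>
  have "complex_dim K \<in> (\<lambda>\<sigma>. int (card \<sigma>) - 1) ` K"
    unfolding complex_dim_def using K by (intro Max_in) auto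
  then obtain \<sigma> where \<sigma>: "\<sigma> \<in> K" "card \<sigma> = r + 1" using assms(3) by auto
  note faces_ge = choose_le_face_count[OF assms(2) \<sigma>(1), unfolded \<sigma>(2)]
  have top: "1 \<le> face_count K (int r)" using faces_ge[of "r + 1"] by simp
  have facets: "face_count K (int r - 1) \<noteq> 0" using faces_ge[of r] by simp
  \<comment> \<open>This is the number of (r-2)-faces of an r-simplex. For r = 1 it equals 1, the
    only such face being the empty one.\<close>
  have "(r + 1) choose (r - 1) = (r + 1) choose 2"
    using binomial_symmetric[of 2 "r + 1"] assms(1) by (simp add: numeral_2_eq_2)
  then have "(r + 1) choose 2 \<le> face_count K (int r - 2)"
    using faces_ge[of "r - 1"] assms(1) by (simp add: of_nat_diff)
  moreover have "2 * ((r + 1) choose 2) = r * (r + 1)"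
    by (simp add: choose_two)
  ultimately have "r * (r + 1) \<le> 2 * face_count K (int r - 2)" by linarith
  then have "real r * (real r + 1) \<le> 2 * real (face_count K (int r - 2))"
    by (metis (mono_tags, lifting) of_nat_1 of_nat_add of_nat_le_iff of_nat_mult of_nat_numeral)
  then have "(real r + 1) / 2 \<le> real (face_count K (int r - 2)) / real r"
    using assms(1) by (simp add: field_simps)
  \<comment> \<open>The extra r in the row sum bound is split as (r - 1)/2 + (r + 1)/2. The first
    part is absorbed by the surplus of (r + 1)/2 times the number of r-faces over that number
    itself, the second by the term with (r-2)-faces.\<close>
  moreover have "(real r - 1) / 2 \<le> (real r - 1) / 2 * real (face_count K (int r))"
    using mult_left_mono[of 1 "real (face_count K (int r))" "(real r - 1) / 2"] top assms(1) by simp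
  ultimately have "real (face_count K (int r)) + real r
      \<le> (real r + 1) / 2 * real (face_count K (int r)) + real (face_count K (int r - 2)) / real r"
    by (simp add: field_simps)
  with largest_eigenvalue_up_laplacian_le[OF assms(2) facets] show ?thesis by linarith
qed

end
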